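(* Consider the plant $x_{k+1}=A_px_k+B_pu_k$, $y_k=C_px_k$ with $x_k\in\mathbb{R}^n$, $u_k\in\mathbb{R}^m$, $y_k\in\mathbb{R}^p$. Let $\mathcal{X}\subset\mathbb{R}^n$ be compact, let $x_0\sim\mu$ with $\mu$ a probability measure supported on $\mathcal{X}$, let $S_0=\mathbb{E}[x_0x_0^\top]$, let $\mathcal{U}=\{u:H_uu\le h_u\}$ be a compact polytope, let $\beta\in(0,1]$, $Q\succeq0$, and let the cost of a controller $\pi$ be $J_\beta(\pi)=\mathbb{E}\sum_{k=0}^\infty\beta^kx_k^\top Qx_k$. Let $\pi_{\rm NN}$ be the static implicit controller $\eta=\phi(W\eta+Uy)$, $u=\pi_{\rm NN}(y)=Ky+V\eta$, where $\phi$ is componentwise nonexpansive and satisfies the static sector condition with diagonal matrices $D_0,D_1$, and $\lambda_{\mathrm{pf}}(|W|)<1$. Assume it is admissible on the closed-loop trajectories issuing from $\mathcal{X}$: $$H_u\pi_{\rm NN}(C_px_k)\le h_u\qquad\text{for all }k\ge0\text{ and all }x_0\in\mathcal{X}.$$ Suppose there exist $P\succ0$ in $\mathbb{R}^{n\times n}$ and a diagonal $\Lambda\succeq0$ in $\mathbb{R}^{q\times q}$ with $$\beta F^\top PF-X^\top PX+X^\top QX+M_\Lambda\preceq0$$ and $$\mathrm{tr}(PS_0)<L_{\rm lin}.$$ Then $\pi_{\rm NN}$ has strictly smaller expected discounted cost $J_\beta$ than every admissible finite-dimensional dynamic linear output-feedback controller in the benchmark class.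
   Context: Componentwise nonexpansive: $\phi:\mathbb{R}^q\to\mathbb{R}^q$ acts componentwise, $\phi(r)_i=\phi_i(r_i)$, and $|\phi(r)-\phi(s)|\le|r-s|$ for all $r,s$, with componentwise absolute values and inequalities. Static sector condition: $\phi(0)=0$ and there are diagonal matrices $D_0=\mathrm{diag}(\underline m_i)$, $D_1=\mathrm{diag}(\overline m_i)$ with $0\le\underline m_i\le\overline m_i\le1$ such that $(\phi_i(z_i)-\underline m_iz_i)(\overline m_iz_i-\phi_i(z_i))\ge0$ for all $z_i\in\mathbb{R}$, $i=1,\dots,q$. Notation: $X=[I_n\;\;0]\in\mathbb{R}^{n\times(n+q)}$, $H=[0\;\;I_q]\in\mathbb{R}^{q\times(n+q)}$, $Z=[UC_p\;\;W]$, $F=[A_p+B_pKC_p\;\;B_pV]$, and $$M_\Lambda=-2Z^\top D_0\Lambda D_1Z+\mathrm{He}\big(H^\top\Lambda(D_0+D_1)Z\big)-2H^\top\Lambda H,\qquad\mathrm{He}(Y)=Y+Y^\top.$$ $P\succ0$ means symmetric positive definite; $\preceq,\succeq$ denote the semidefinite order; $|W|$ is the componentwise absolute value; $\lambda_{\mathrm{pf}}(|W|)$ is the Perron--Frobenius eigenvalue (spectral radius) of $|W|$; $\|x\|_Q^2=x^\top Qx$. All matrices are real of compatible dimensions. At each time $\eta$ is the unique solution of the fixed-point equation. Benchmark class: finite-dimensional LTI dynamic output-feedback controllers (of any order) $\xi_{k+1}=A_c\xi_k+B_cy_k$, $u_k=C_c\xi_k+D_cy_k$, with fixed initial controller state $\xi_0$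 (independent of $x_0$), that are input-admissible: $H_uu_k\le h_u$ for all $k\ge0$ and all $x_0\in\mathcal{X}$. Affine first-move lower bound: with $$\mathcal{A}^y_{\rm aff}=\{(D_y,d)\in\mathbb{R}^{m\times p}\times\mathbb{R}^m:\ H_u(D_yC_px+d)\le h_u\ \ \forall x\in\mathcal{X}\},$$ $$L_{\rm lin}=\mathbb{E}[x_0^\top Qx_0]+\beta\min_{(D_y,d)\in\mathcal{A}^y_{\rm aff}}\mathbb{E}\left[\|A_px_0+B_p(D_yC_px_0+d)\|_Q^2\right].$$ Costs take values in $[0,+\infty]$. *)

theory Defs
  imports "HOL-Probability.Probability"
begin

definition quad :: "real^'a^'a \<Rightarrow> real^'a \<Rightarrow> real"
  where "quad Q x = x \<bullet> (Q *v x)"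

text \<open>The order \<open>\<le>\<close> on \<^typ>\<open>real^'a^'a\<close> is entrywise, so the semidefinite order needs
  its own name.\<close>

definition psd :: "real^'a^'a \<Rightarrow> bool"
  where "psd A \<longleftrightarrow> transpose A = A \<and> (\<forall>x. 0 \<le> quad A x)"

definition pos_def :: "real^'a^'a \<Rightarrow> bool"
  where "pos_def A \<longleftrightarrow> transpose A = A \<and> (\<forall>x. x \<noteq> 0 \<longrightarrow> 0 < quad A x)"

definition loewner_le :: "real^'a^'a \<Rightarrow> real^'a^'a \<Rightarrow> bool"
  where "loewner_le A B \<longleftrightarrow> psd (B - A)"

definition diag :: "real^'a \<Rightarrow> real^'a^'a"
  where "diag v = (\<chi> i j. if i = j then v $ i else 0)"

definition is_diagonal :: "real^'a^'a \<Rightarrow> bool"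
  where "is_diagonal A \<longleftrightarrow> (\<forall>i j. i \<noteq> j \<longrightarrow> A $ i $ j = 0)"

definition He :: "real^'a^'a \<Rightarrow> real^'a^'a"
  where "He Y = Y + transpose Y"

definition hcat :: "real^'a^'r \<Rightarrow> real^'b^'r \<Rightarrow> real^('a::finite + 'b::finite)^'r"
  where "hcat A B = (\<chi> i j. case j of Inl a \<Rightarrow> A $ i $ a | Inr b \<Rightarrow> B $ i $ b)"

text \<open>The spectral radius, taken over the complex eigenvalues; for an entrywise nonnegative
  matrix it is the Perron--Frobenius eigenvalue.\<close>

definition complex_eigenvalues :: "real^'a^'a \<Rightarrow> complex set"
  where "complex_eigenvalues A =
    {c. \<exists>v :: complex^'a. v \<noteq> 0 \<and> (\<chi> i j. complex_of_real (A $ i $ j)) *v v = c *s v}"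

definition lambda_pf :: "real^'a^'a \<Rightarrow> real"
  where "lambda_pf A = Sup (cmod ` complex_eigenvalues A)"

definition act :: "('q::finite \<Rightarrow> real \<Rightarrow> real) \<Rightarrow> real^'q \<Rightarrow> real^'q"
  where "act \<phi> r = (\<chi> i. \<phi> i (r $ i))"

text \<open>On vectors and matrices \<open>\<bar>_\<bar>\<close> and \<open>\<le>\<close> are componentwise.\<close>

definition nonexpansive :: "('q::finite \<Rightarrow> real \<Rightarrow> real) \<Rightarrow> bool"
  where "nonexpansive \<phi> \<longleftrightarrow> (\<forall>r s :: real^'q. \<bar>act \<phi> r - act \<phi> s\<bar> \<le> \<bar>r - s\<bar>)"

definition static_sector :: "('q::finite \<Rightarrow> real \<Rightarrow> real) \<Rightarrow> real^'q \<Rightarrow> real^'q \<Rightarrow> bool"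
  where "static_sector \<phi> lo hi \<longleftrightarrow>
    act \<phi> 0 = 0 \<and>
    (\<forall>i. 0 \<le> lo $ i \<and> lo $ i \<le> hi $ i \<and> hi $ i \<le> 1) \<and>
    (\<forall>i z. 0 \<le> (\<phi> i z - lo $ i * z) * (hi $ i * z - \<phi> i z))"

text \<open>The fixed-point equation has exactly one solution when \<open>\<phi>\<close> is nonexpansive and
  \<open>lambda_pf \<bar>W\<bar> < 1\<close>.\<close>

definition implicit_eta ::
  "('q::finite \<Rightarrow> real \<Rightarrow> real) \<Rightarrow> real^'q^'q \<Rightarrow> real^'p^'q \<Rightarrow> real^'p \<Rightarrow> real^'q"
  where "implicit_eta \<phi> W U y = (THE \<eta>. \<eta> = act \<phi> (W *v \<eta> + U *v y))"

definition pi_NN ::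
  "('q::finite \<Rightarrow> real \<Rightarrow> real) \<Rightarrow> real^'q^'q \<Rightarrow> real^'p^'q \<Rightarrow> real^'p^'m \<Rightarrow> real^'q^'m \<Rightarrow> real^'p \<Rightarrow> real^'m"
  where "pi_NN \<phi> W U K V y = K *v y + V *v implicit_eta \<phi> W U y"

primrec static_loop ::
  "real^'n^'n \<Rightarrow> real^'m^'n \<Rightarrow> real^'n^'p \<Rightarrow> (real^'p \<Rightarrow> real^'m) \<Rightarrow> real^'n \<Rightarrow> nat \<Rightarrow> real^'n"
  where
    "static_loop Ap Bp Cp \<pi> x0 0 = x0"
  | "static_loop Ap Bp Cp \<pi> x0 (Suc k) =
       Ap *v static_loop Ap Bp Cp \<pi> x0 k + Bp *v \<pi> (Cp *v static_loop Ap Bp Cp \<pi> x0 k)"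

text \<open>The order is a natural number, possibly 0, so that it can be quantified over. The
  controller state is a function on \<^typ>\<open>nat\<close> of which only the values at indices below the
  order are ever read; \<open>ctrl_B\<close> lists the rows of the input matrix and \<open>ctrl_C\<close> the
  columns of the output matrix.\<close>

record ('m::finite, 'p::finite) lti_controller =
  ctrl_order :: nat
  ctrl_A :: "nat \<Rightarrow> nat \<Rightarrow> real"
  ctrl_B :: "nat \<Rightarrow> real^'p"
  ctrl_C :: "nat \<Rightarrow> real^'m"
  ctrl_D :: "real^'p^'m"
  ctrl_init :: "nat \<Rightarrow> real"

definition ctrl_next :: "('m::finite, 'p::finite) lti_controller \<Rightarrow> (nat \<Rightarrow> real) \<Rightarrow> real^'p \<Rightarrow> nat \<Rightarrow> real"
  where "ctrl_next c \<xi> y = (\<lambda>i. (\<Sum>j<ctrl_order c. ctrl_A c i j * \<xi> j) + ctrl_B c i \<bullet> y)"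

definition ctrl_output :: "('m::finite, 'p::finite) lti_controller \<Rightarrow> (nat \<Rightarrow> real) \<Rightarrow> real^'p \<Rightarrow> real^'m"
  where "ctrl_output c \<xi> y = (\<Sum>j<ctrl_order c. \<xi> j *\<^sub>R ctrl_C c j) + ctrl_D c *v y"

primrec lti_loop ::
  "real^'n^'n \<Rightarrow> real^'m^'n \<Rightarrow> real^'n^'p \<Rightarrow> ('m::finite, 'p::finite) lti_controller \<Rightarrow> real^'n \<Rightarrow> nat
    \<Rightarrow> (real^'n) \<times> (nat \<Rightarrow> real)"
  where
    "lti_loop Ap Bp Cp c x0 0 = (x0, ctrl_init c)"
  | "lti_loop Ap Bp Cp c x0 (Suc k) =
       (let (x, \<xi>) = lti_loop Ap Bp Cp c x0 k; y = Cp *v x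
        in (Ap *v x + Bp *v ctrl_output c \<xi> y, ctrl_next c \<xi> y))"

definition lti_state ::
  "real^'n^'n \<Rightarrow> real^'m^'n \<Rightarrow> real^'n^'p \<Rightarrow> ('m::finite, 'p::finite) lti_controller \<Rightarrow> real^'n \<Rightarrow> nat \<Rightarrow> real^'n"
  where "lti_state Ap Bp Cp c x0 k = fst (lti_loop Ap Bp Cp c x0 k)"

definition lti_input ::
  "real^'n^'n \<Rightarrow> real^'m^'n \<Rightarrow> real^'n^'p \<Rightarrow> ('m::finite, 'p::finite) lti_controller \<Rightarrow> real^'n \<Rightarrow> nat \<Rightarrow> real^'m"
  where "lti_input Ap Bp Cp c x0 k =
    (let (x, \<xi>) = lti_loop Ap Bp Cp c x0 k in ctrl_output c \<xi> (Cp *v x))"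

definition input_admissible ::
  "real^'m^'r \<Rightarrow> real^'r \<Rightarrow> (real^'n) set \<Rightarrow> (real^'n \<Rightarrow> nat \<Rightarrow> real^'m) \<Rightarrow> bool"
  where "input_admissible Hu hu X u \<longleftrightarrow> (\<forall>k. \<forall>x0\<in>X. Hu *v u x0 k \<le> hu)"

text \<open>The last argument maps an initial state to the resulting state trajectory.\<close>

definition disc_cost ::
  "(real^'n) measure \<Rightarrow> real \<Rightarrow> real^'n^'n \<Rightarrow> (real^'n \<Rightarrow> nat \<Rightarrow> real^'n) \<Rightarrow> ennreal"
  where "disc_cost \<mu> \<beta> Q x = (\<integral>\<^sup>+ x0. (\<Sum>k. ennreal (\<beta> ^ k * quad Q (x x0 k))) \<partial>\<mu>)"

definition second_moment :: "(real^'n) measure \<Rightarrow> real^'n^'n"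
  where "second_moment \<mu> = (\<chi> i j. \<integral>x. x $ i * x $ j \<partial>\<mu>)"

definition aff_moves ::
  "real^'n^'p \<Rightarrow> real^'m^'r \<Rightarrow> real^'r \<Rightarrow> (real^'n) set \<Rightarrow> ((real^'p^'m) \<times> (real^'m)) set"
  where "aff_moves Cp Hu hu X = {(Dy, d). \<forall>x\<in>X. Hu *v (Dy *v (Cp *v x) + d) \<le> hu}"

text \<open>The infimum is a minimum when the input polytope is compact and nonempty: the objective
  depends only on the restriction of \<open>x \<mapsto> Dy Cp x + d\<close> to \<open>X\<close>, and the admissible
  restrictions form a compact subset of a finite-dimensional space.\<close>

definition L_lin ::
  "real^'n^'n \<Rightarrow> real^'m^'n \<Rightarrow> real^'n^'p \<Rightarrow> real^'m^'r \<Rightarrow> real^'r \<Rightarrow> (real^'n) set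
    \<Rightarrow> (real^'n) measure \<Rightarrow> real \<Rightarrow> real^'n^'n \<Rightarrow> real"
  where "L_lin Ap Bp Cp Hu hu X \<mu> \<beta> Q =
    (\<integral>x. quad Q x \<partial>\<mu>) +
    \<beta> * (INF (Dy, d) \<in> aff_moves Cp Hu hu X.
           \<integral>x. quad Q (Ap *v x + Bp *v (Dy *v (Cp *v x) + d)) \<partial>\<mu>)"

definition X_mat :: "real^('n::finite + 'q::finite)^'n"
  where "X_mat = hcat (mat 1) 0"

definition H_mat :: "real^('n::finite + 'q::finite)^'q"
  where "H_mat = hcat 0 (mat 1)"

definition Z_mat :: "real^'p^'q \<Rightarrow> real^'n^'p \<Rightarrow> real^'q^'q \<Rightarrow> real^('n::finite + 'q::finite)^'q"
  where "Z_mat U Cp W = hcat (U ** Cp) W"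

definition F_mat ::
  "real^'n^'n \<Rightarrow> real^'m^'n \<Rightarrow> real^'n^'p \<Rightarrow> real^'p^'m \<Rightarrow> real^'q^'m \<Rightarrow> real^('n::finite + 'q::finite)^'n"
  where "F_mat Ap Bp Cp K V = hcat (Ap + Bp ** K ** Cp) (Bp ** V)"

definition M_mat ::
  "real^'q^'q \<Rightarrow> real^'q^'q \<Rightarrow> real^'q^'q \<Rightarrow> real^('n::finite + 'q::finite)^'q \<Rightarrow> real^('n::finite + 'q::finite)^('n + 'q)"
  where "M_mat D0 D1 \<Lambda> Z =
    (-2) *\<^sub>R (transpose Z ** D0 ** \<Lambda> ** D1 ** Z)
    + He (transpose H_mat ** \<Lambda> ** (D0 + D1) ** Z)
    - 2 *\<^sub>R (transpose H_mat ** \<Lambda> ** H_mat)"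

end

theory Submission
  imports Defs
begin

text \<open>Along the closed loop of the implicit controller, the linear matrix inequality evaluated at
  \<open>(x, \<eta>)\<close> together with the sector condition gives the dissipation inequality
  \<open>\<beta> * quad P x' + quad Q x \<le> quad P x\<close>; telescoping bounds the cost by the mean of
  \<open>quad P\<close>, which is \<open>trace (P ** second_moment \<mu>)\<close>. Conversely, the initial state of a linear controller is independent
  of the plant state, so its first move is an admissible affine function of the output, and the
  first two stages of its cost already amount to at least \<open>L_lin\<close>.\<close>

section \<open>Well-posedness of the implicit layer\<close>

text \<open>A supremum in the reals bounds the members of its set only if the set is bounded above.
  Reading the eigenvalue equation at a component of largest modulus bounds every eigenvalue by the
  sum of the absolute values of all entries.\<close>

lemma complex_eigenvalues_bdd:
  fixes A :: "real^'a^'a"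
  shows "bdd_above (cmod ` complex_eigenvalues A)"
proof (rule bdd_aboveI2)
  fix c assume "c \<in> complex_eigenvalues A"
  then obtain v :: "complex^'a" where v: "v \<noteq> 0"
    "(\<chi> i j. complex_of_real (A $ i $ j)) *v v = c *s v"
    by (auto simp: complex_eigenvalues_def)
  define m where "m = Max (range (\<lambda>i. cmod (v $ i)))"
  have le: "cmod (v $ i) \<le> m" for i unfolding m_def by (rule Max_ge) auto
  have "m \<in> range (\<lambda>i. cmod (v $ i))" unfolding m_def by (rule Max_in) auto
  then obtain i where i: "cmod (v $ i) = m" by auto
  have mpos: "m > 0"
  proof -
    obtain j where "v $ j \<noteq> 0" using v(1) by (auto simp: vec_eq_iff)
    then show ?thesis using le[of j] by (meson less_le_trans zero_less_norm_iff)
  qed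
  have "c * v $ i = (\<Sum>j\<in>UNIV. complex_of_real (A $ i $ j) * v $ j)"
    using v(2) by (auto simp: vec_eq_iff matrix_vector_mult_def)
  then have "cmod c * m = cmod (\<Sum>j\<in>UNIV. complex_of_real (A $ i $ j) * v $ j)"
    by (metis i norm_mult)
  also have "\<dots> \<le> (\<Sum>j\<in>UNIV. \<bar>A $ i $ j\<bar> * m)"
    by (rule sum_norm_le) (auto simp: norm_mult intro!: mult_left_mono le)
  also have "\<dots> \<le> (\<Sum>i\<in>UNIV. \<Sum>j\<in>UNIV. \<bar>A $ i $ j\<bar> * m)"
    using mpos by (intro member_le_sum) (auto intro!: sum_nonneg)
  also have "\<dots> = (\<Sum>i\<in>UNIV. \<Sum>j\<in>UNIV. \<bar>A $ i $ j\<bar>) * m"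
    by (simp add: sum_distrib_right)
  finally show "cmod c \<le> (\<Sum>i\<in>UNIV. \<Sum>j\<in>UNIV. \<bar>A $ i $ j\<bar>)"
    using mpos by simp
qed

text \<open>A real eigenvector is also a complex one, so \<open>t\<close> lies in the set whose
  supremum is \<open>lambda_pf A\<close>.\<close>

lemma real_eigenvalue_le_lambda_pf:
  fixes A :: "real^'a^'a"
  assumes "A *v v = t *\<^sub>R v" "v \<noteq> 0"
  shows "\<bar>t\<bar> \<le> lambda_pf A"
proof -
  have "complex_of_real t \<in> complex_eigenvalues A"
    unfolding complex_eigenvalues_def
  proof (intro CollectI exI conjI)
    show "(\<chi> i. complex_of_real (v $ i)) \<noteq> 0" using assms(2) by (auto simp: vec_eq_iff)
    have "(\<Sum>j\<in>UNIV. A $ i $ j * v $ j) = t * v $ i" for i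
      using assms(1) by (auto simp: vec_eq_iff matrix_vector_mult_def)
    then have "(\<Sum>j\<in>UNIV. complex_of_real (A $ i $ j) * complex_of_real (v $ j))
        = complex_of_real t * complex_of_real (v $ i)" for i
      by (metis (no_types, lifting) of_real_mult of_real_sum sum.cong)
    then show "(\<chi> i j. complex_of_real (A $ i $ j)) *v (\<chi> i. complex_of_real (v $ i))
        = complex_of_real t *s (\<chi> i. complex_of_real (v $ i))"
      by (simp add: vec_eq_iff matrix_vector_mult_def)
  qed
  then have "cmod (complex_of_real t) \<le> lambda_pf A"
    unfolding lambda_pf_def by (intro cSUP_upper complex_eigenvalues_bdd)
  then show ?thesis by simp
qed

lemma continuous_on_det:
  fixes M :: "'b::topological_space \<Rightarrow> real^'a^'a"
  assumes "\<And>i j. continuous_on S (\<lambda>s. M s $ i $ j)"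
  shows "continuous_on S (\<lambda>s. det (M s))"
  unfolding det_def by (intro continuous_intros assms)

text \<open>The witness solves \<open>v = 1 + A v\<close>. It is positive by continuation in \<open>s\<close> along the
  solutions of \<open>v = 1 + s A v\<close>: a nonnegative solution is at least 1, so nonnegativity is both an
  open and a closed condition on \<open>s\<close>.\<close>

lemma positive_supersolution:
  fixes A :: "real^'a^'a"
  assumes nonneg: "\<And>i j. 0 \<le> A $ i $ j" and pf: "lambda_pf A < 1"
  obtains v :: "real^'a" where "\<And>i. 1 \<le> v $ i" "\<And>i. (A *v v) $ i = v $ i - 1"
proof -
  define M where "M s = mat 1 - s *\<^sub>R A" for s :: real
  have Mv: "M s *v x = x - s *\<^sub>R (A *v x)" for s x
    by (simp add: M_def matrix_vector_mult_diff_rdistrib scaleR_matrix_vector_assoc)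
  have inv: "det (M s) \<noteq> 0" if s: "s \<in> {0..1}" for s
  proof -
    \<comment> \<open>A nonzero kernel vector of \<open>M s\<close> would be an eigenvector of
      \<open>A\<close> for the eigenvalue \<open>1 / s\<close>, which is at least 1 and so
      contradicts \<open>pf\<close>.\<close>
    have "x = 0" if "M s *v x = 0" for x
    proof (rule ccontr)
      assume "x \<noteq> 0"
      have eq: "x = s *\<^sub>R (A *v x)" using that Mv by simp
      then have "s \<noteq> 0" using \<open>x \<noteq> 0\<close> by auto
      then have "A *v x = (1 / s) *\<^sub>R x" using eq
        by (metis divideR_right inverse_eq_divide)
      then have "\<bar>1 / s\<bar> \<le> lambda_pf A"
        using \<open>x \<noteq> 0\<close> by (rule real_eigenvalue_le_lambda_pf)
      moreover have "1 \<le> \<bar>1 / s\<bar>" using s \<open>s \<noteq> 0\<close> by simp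
      ultimately show False using pf by linarith
    qed
    then have "invertible (M s)"
      using matrix_left_invertible_ker invertible_left_inverse by blast
    then show ?thesis by (simp add: invertible_det_nz)
  qed
  \<comment> \<open>Cramer's rule for \<open>M s *v v s = 1\<close>: each component is a quotient of
    determinants, which makes continuity in \<open>s\<close> immediate.\<close>
  define v :: "real \<Rightarrow> real^'a"
    where "v s = (\<chi> k. det (\<chi> i j. if j = k then 1 else M s $ i $ j) / det (M s))" for s
  have v: "v s = 1 + s *\<^sub>R (A *v v s)" if "s \<in> {0..1}" for s
  proof -
    have "M s *v v s = 1"
      by (subst cramer[OF inv[OF that]]) (simp add: v_def cong: if_cong)
    then show ?thesis by (simp add: Mv algebra_simps)
  qed
  have cont: "continuous_on {0..1} (\<lambda>s. v s $ k)" for k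
  proof -
    have M: "continuous_on {0..1} (\<lambda>s. M s $ i $ j)" for i j
      unfolding M_def by (auto intro!: continuous_intros)
    have "continuous_on {0..1} (\<lambda>s. det (\<chi> i j. if j = k then 1 else M s $ i $ j))"
    proof (rule continuous_on_det)
      show "continuous_on {0..1} (\<lambda>s. (\<chi> i j. if j = k then 1 else M s $ i $ j) $ i $ j)" for i j
        by (cases "j = k") (simp_all add: M)
    qed
    moreover have "continuous_on {0..1} (\<lambda>s. det (M s))"
      by (rule continuous_on_det) (rule M)
    ultimately show ?thesis
      unfolding v_def vec_lambda_beta by (intro continuous_on_divide) (use inv in auto)
  qed
  have ge1: "1 \<le> v s $ k" if s: "s \<in> {0..1}" and ge0: "\<And>i. 0 \<le> v s $ i" for s k
  proof -
    have "0 \<le> (A *v v s) $ k"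
      unfolding matrix_vector_mult_def by (auto intro!: sum_nonneg mult_nonneg_nonneg nonneg ge0)
    moreover have "v s $ k = 1 + s * (A *v v s) $ k"
      by (subst v[OF s]) simp
    ultimately show ?thesis using s by simp
  qed
  define S where "S = {s \<in> {0..1}. \<forall>i. 0 \<le> v s $ i}"
  have "S = (\<Inter>i. {0..1} \<inter> (\<lambda>s. v s $ i) -` {0..})"
    by (auto simp: S_def)
  moreover have "closedin (top_of_set {0..1}) ({0..1} \<inter> (\<lambda>s. v s $ i) -` {0..})" for i
    by (intro continuous_closedin_preimage cont) auto
  ultimately have closed: "closedin (top_of_set {0..1}) S"
    by (simp only:) (rule closedin_Inter; auto)
  \<comment> \<open>By \<open>ge1\<close> the strict inequalities cut out the same set; being
    finitely many, they make it relatively open.\<close>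
  have "S = (\<Inter>i. {0..1} \<inter> (\<lambda>s. v s $ i) -` {0<..})"
    using ge1 by (fastforce simp: S_def intro: less_imp_le less_le_trans[OF zero_less_one])
  moreover have "openin (top_of_set {0..1}) ({0..1} \<inter> (\<lambda>s. v s $ i) -` {0<..})" for i
    by (intro continuous_openin_preimage_gen cont) auto
  ultimately have "openin (top_of_set {0..1}) S"
    by (simp only:) (rule openin_Inter; auto)
  moreover have "0 \<in> S" using v[of 0] by (auto simp: S_def)
  moreover have "connected {0..1::real}" by simp
  ultimately have "S = {0..1}"
    using closed by (metis connected_clopen empty_iff)
  then have "1 \<in> S" by simp
  then have "0 \<le> v 1 $ i" for i by (auto simp: S_def)
  show thesis
  proof (rule that)
    show "1 \<le> v 1 $ i" for i using ge1 \<open>\<And>i. 0 \<le> v 1 $ i\<close> by simp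
    have "v 1 = 1 + A *v v 1" using v[of 1] by simp
    then have "v 1 $ i = 1 + (A *v v 1) $ i" for i
      by (metis one_index vector_add_component)
    then show "(A *v v 1) $ i = v 1 $ i - 1" for i by (simp add: algebra_simps)
  qed
qed

lemma nonexpansive_component:
  fixes \<phi> :: "'q::finite \<Rightarrow> real \<Rightarrow> real"
  assumes "nonexpansive \<phi>"
  shows "\<bar>\<phi> i a - \<phi> i b\<bar> \<le> \<bar>a - b\<bar>"
proof -
  have "\<bar>act \<phi> (\<chi> i. a) - act \<phi> (\<chi> i. b)\<bar> \<le> \<bar>(\<chi> i. a) - (\<chi> i. b) :: real^'q\<bar>"
    using assms by (simp add: nonexpansive_def)
  then show ?thesis
    by (simp add: less_eq_vec_def act_def abs_vec_def)
qed

text \<open>An estimate in the maximum norm weighted by \<open>v\<close>. If \<open>v\<close>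
  satisfies \<open>\<bar>W\<bar> *v v = v - 1\<close>, the bound becomes
  \<open>m * (v $ i - 1)\<close>, strictly below \<open>m * v $ i\<close> when
  \<open>m > 0\<close>.\<close>

lemma abs_matrix_vector_le:
  fixes W :: "real^'a^'b"
  assumes "\<And>j. \<bar>x $ j\<bar> \<le> m * v $ j"
  shows "\<bar>(W *v x) $ i\<bar> \<le> m * (\<bar>W\<bar> *v v) $ i"
proof -
  have "\<bar>(W *v x) $ i\<bar> \<le> (\<Sum>j\<in>UNIV. \<bar>W $ i $ j\<bar> * (m * v $ j))"
    unfolding matrix_vector_mult_def vec_lambda_beta
    by (rule order_trans[OF sum_abs]) (auto simp: abs_mult intro!: sum_mono mult_left_mono assms)
  also have "\<dots> = m * (\<bar>W\<bar> *v v) $ i"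
    by (simp add: matrix_vector_mult_def abs_vec_def sum_distrib_left algebra_simps)
  finally show ?thesis .
qed

text \<open>The definite description in \<open>implicit_eta\<close> is meaningful only with a unique
  solution. The weight \<open>v\<close> from \<open>positive_supersolution\<close> serves twice:
  Brouwer's theorem on a box proportional to \<open>v\<close> gives existence, and the maximum norm
  weighted by \<open>v\<close> gives uniqueness.\<close>

lemma implicit_eta_fixpoint:
  fixes \<phi> :: "'q::finite \<Rightarrow> real \<Rightarrow> real" and U :: "real^'p^'q"
  assumes ne: "nonexpansive \<phi>" and pf: "lambda_pf \<bar>W\<bar> < 1"
  shows "implicit_eta \<phi> W U y = act \<phi> (W *v implicit_eta \<phi> W U y + U *v y)"
proof -
  obtain v where v1: "\<And>i. 1 \<le> v $ i" and v: "\<And>i. (\<bar>W\<bar> *v v) $ i = v $ i - 1"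
    by (rule positive_supersolution[OF _ pf]) (auto simp: abs_vec_def)
  define T where "T x = act \<phi> (W *v x + U *v y)" for x
  \<comment> \<open>\<open>R\<close> dominates the contributions of the input and of
    \<open>\<phi> i 0\<close>. Since \<open>v\<close> loses 1 under \<open>\<bar>W\<bar>\<close>, a
    point of the box is sent to components of size at most
    \<open>R * (v $ i - 1) + R = R * v $ i\<close>, so the box is invariant.\<close>
  define R where "R = (\<Sum>i\<in>UNIV. \<bar>(U *v y) $ i\<bar> + \<bar>\<phi> i 0\<bar>)"
  have R: "\<bar>(U *v y) $ i\<bar> + \<bar>\<phi> i 0\<bar> \<le> R" for i
    unfolding R_def by (rule member_le_sum) auto
  have "R \<ge> 0" unfolding R_def by (intro sum_nonneg) auto
  define B where "B = cbox (- (R *\<^sub>R v)) (R *\<^sub>R v)"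
  have B: "x \<in> B \<longleftrightarrow> (\<forall>i. \<bar>x $ i\<bar> \<le> R * v $ i)" for x
    by (auto simp: B_def mem_box_cart abs_le_iff minus_le_iff)
  have contphi: "continuous_on UNIV (\<phi> i)" for i
    unfolding continuous_on_iff dist_real_def
    by (metis le_less_trans nonexpansive_component[OF ne])
  have contT: "continuous_on B T"
    unfolding T_def act_def
    by (intro continuous_intros continuous_on_compose2[OF contphi]
        linear_continuous_on matrix_vector_mul_bounded_linear) auto
  have "T x \<in> B" if x: "x \<in> B" for x
    unfolding B
  proof
    fix i
    have "\<bar>T x $ i\<bar> \<le> \<bar>(W *v x + U *v y) $ i\<bar> + \<bar>\<phi> i 0\<bar>"
      using nonexpansive_component[OF ne, of i "(W *v x + U *v y) $ i" 0]
      by (simp add: T_def act_def)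
    also have "\<dots> \<le> \<bar>(W *v x) $ i\<bar> + R" using R[of i] by simp
    also have "\<bar>(W *v x) $ i\<bar> \<le> R * (v $ i - 1)"
      using abs_matrix_vector_le[of x R v W i] x v by (simp add: B)
    finally show "\<bar>T x $ i\<bar> \<le> R * v $ i" by (simp add: algebra_simps)
  qed
  moreover have "0 \<in> B" using \<open>R \<ge> 0\<close> v1 by (auto simp: B intro!: mult_nonneg_nonneg intro: order_trans[OF zero_le_one])
  ultimately obtain e where e: "T e = e"
    using brouwer[of B T] contT by (auto simp: B_def)
  have "e' = e" if e': "e' = T e'" for e'
  proof -
    define d where "d = e' - e"
    \<comment> \<open>The weighted maximum norm of the difference of two fixed points. At an index
      attaining it, \<open>m * v $ i \<le> m * (v $ i - 1)\<close>, which forces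
      \<open>m \<le> 0\<close>.\<close>
    define m where "m = Max (range (\<lambda>i. \<bar>d $ i\<bar> / v $ i))"
    have vpos: "0 < v $ i" for i using v1[of i] by simp
    have "\<bar>d $ i\<bar> / v $ i \<le> m" for i unfolding m_def by (rule Max_ge) auto
    then have dm: "\<bar>d $ i\<bar> \<le> m * v $ i" for i using vpos by (simp add: pos_divide_le_eq)
    have "m \<in> range (\<lambda>i. \<bar>d $ i\<bar> / v $ i)" unfolding m_def by (rule Max_in) auto
    then obtain i where "m = \<bar>d $ i\<bar> / v $ i" by auto
    then have i: "\<bar>d $ i\<bar> = m * v $ i" using vpos[of i] by simp
    have "\<bar>d $ i\<bar> = \<bar>T e' $ i - T e $ i\<bar>" using e e' by (simp add: d_def)
    also have "\<dots> \<le> \<bar>(W *v d) $ i\<bar>"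
      using nonexpansive_component[OF ne, of i "(W *v e' + U *v y) $ i" "(W *v e + U *v y) $ i"]
      by (simp add: T_def act_def d_def matrix_vector_mult_diff_distrib)
    also have "\<dots> \<le> m * (v $ i - 1)"
      using abs_matrix_vector_le[of d m v W i] dm v by simp
    finally have "m \<le> 0" using i by (simp add: algebra_simps)
    then have "\<bar>d $ j\<bar> \<le> 0" for j
      using dm[of j] vpos[of j] by (meson less_imp_le mult_nonpos_nonneg order_trans)
    then show ?thesis by (simp add: d_def vec_eq_iff)
  qed
  then have "\<exists>!\<eta>. \<eta> = act \<phi> (W *v \<eta> + U *v y)"
    using e unfolding T_def by metis
  then show ?thesis unfolding implicit_eta_def by (rule theI')
qed

section \<open>Quadratic forms\<close>

lemma quad_add: "quad (A + B) x = quad A x + quad B x"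
  by (simp add: quad_def matrix_vector_mult_add_rdistrib inner_right_distrib)

lemma quad_diff: "quad (A - B) x = quad A x - quad B x"
  by (simp add: quad_def matrix_vector_mult_diff_rdistrib inner_diff_right)

lemma quad_scaleR: "quad (c *\<^sub>R A) x = c * quad A x"
  by (simp add: quad_def scaleR_matrix_vector_assoc[symmetric])

lemma inner_transpose_mult:
  fixes S :: "real^'a^'b"
  shows "x \<bullet> (transpose S *v y) = (S *v x) \<bullet> y"
  by (metis dot_lmul_matrix inner_commute transpose_matrix_vector transpose_transpose)

lemma quad_congruence: "quad (transpose S ** A ** S) x = quad A (S *v x)"
  by (simp add: quad_def matrix_vector_mul_assoc[symmetric] inner_transpose_mult
      del: transpose_matrix_vector)

lemma quad_He: "quad (He Y) x = 2 * quad Y x"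
  by (simp add: quad_def He_def matrix_vector_mult_add_rdistrib inner_right_distrib
      inner_transpose_mult inner_commute del: transpose_matrix_vector)

lemma quad_sum: "quad A x = (\<Sum>i\<in>UNIV. \<Sum>j\<in>UNIV. A $ i $ j * (x $ i * x $ j))"
  by (simp add: quad_def inner_vec_def matrix_vector_mult_def sum_distrib_left algebra_simps)

lemma continuous_on_quad: "continuous_on S f \<Longrightarrow> continuous_on S (\<lambda>x. quad A (f x))"
  unfolding quad_def
  by (intro continuous_intros continuous_on_compose2[OF linear_continuous_on
        [OF matrix_vector_mul_bounded_linear]]) auto

lemma diagonal_mult_vec:
  assumes "is_diagonal A"
  shows "(A *v x) $ i = A $ i $ i * x $ i"
proof -
  have "(A *v x) $ i = (\<Sum>j\<in>{i}. A $ i $ j * x $ j)"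
    unfolding matrix_vector_mult_def vec_lambda_beta
    using assms by (intro sum.mono_neutral_right) (auto simp: is_diagonal_def)
  then show ?thesis by simp
qed

lemma is_diagonal_diag: "is_diagonal (diag v)"
  by (simp add: is_diagonal_def diag_def)

lemma is_diagonal_add: "is_diagonal A \<Longrightarrow> is_diagonal B \<Longrightarrow> is_diagonal (A + B)"
  by (simp add: is_diagonal_def)

lemma psd_diagonal_nonneg:
  assumes "psd A"
  shows "0 \<le> A $ i $ i"
proof -
  have "0 \<le> quad A (axis i 1)" using assms by (simp add: psd_def)
  also have "\<dots> = A $ i $ i"
    by (simp add: quad_def inner_axis' matrix_vector_mul_component inner_axis)
  finally show ?thesis .
qed

text \<open>The stacked vector on which a block row \<open>hcat A B\<close> acts blockwise; the
  matrix inequality is evaluated at such vectors.\<close>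

definition vcat :: "real^'a \<Rightarrow> real^'b \<Rightarrow> real^('a::finite + 'b::finite)"
  where "vcat x y = (\<chi> j. case j of Inl a \<Rightarrow> x $ a | Inr b \<Rightarrow> y $ b)"

lemma hcat_vcat: "hcat A B *v vcat x y = A *v x + B *v y"
proof -
  have "(hcat A B *v vcat x y) $ i = (A *v x + B *v y) $ i" for i
  proof -
    have "(hcat A B *v vcat x y) $ i
        = (\<Sum>j\<in>UNIV <+> UNIV. hcat A B $ i $ j * vcat x y $ j)"
      by (simp add: matrix_vector_mult_def)
    also have "\<dots> = (A *v x + B *v y) $ i"
      by (subst sum.Plus) (auto simp: hcat_def vcat_def matrix_vector_mult_def)
    finally show ?thesis .
  qed
  then show ?thesis by (simp add: vec_eq_iff)
qed

section \<open>Upper bound for the implicit controller\<close>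

text \<open>As all the matrices inside the multiplier are diagonal, its quadratic form decouples
  into one term per neuron: \<open>2 * \<Lambda> $ i $ i\<close> times the sector product at
  \<open>z $ i\<close>. Both factors are nonnegative.\<close>

lemma sector_multiplier_nonneg:
  fixes \<Lambda> :: "real^'q^'q" and Z :: "real^('n::finite + 'q::finite)^'q"
  assumes diag: "is_diagonal \<Lambda>" and psd: "psd \<Lambda>" and sec: "static_sector \<phi> lo hi"
    and \<eta>: "H_mat *v \<zeta> = act \<phi> (Z *v \<zeta>)"
  shows "0 \<le> quad (M_mat (diag lo) (diag hi) \<Lambda> Z) \<zeta>"
proof -
  define z where "z = Z *v \<zeta>"
  define h where "h = H_mat *v \<zeta>"
  have h: "h $ i = \<phi> i (z $ i)" for i using \<eta> by (simp add: h_def z_def act_def)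
  have d: "diag u $ i $ i = u $ i" for u :: "real^'q" and i by (simp add: diag_def)
  have "quad (transpose Z ** diag lo ** \<Lambda> ** diag hi ** Z) \<zeta>
      = z \<bullet> (diag lo *v (\<Lambda> *v (diag hi *v z)))"
    by (simp add: quad_def matrix_vector_mul_assoc[symmetric] inner_transpose_mult z_def
        del: transpose_matrix_vector)
  moreover have "quad (transpose H_mat ** \<Lambda> ** (diag lo + diag hi) ** Z) \<zeta>
      = h \<bullet> (\<Lambda> *v ((diag lo + diag hi) *v z))"
    by (simp add: quad_def matrix_vector_mul_assoc[symmetric] inner_transpose_mult z_def h_def
        del: transpose_matrix_vector)
  moreover have "quad (transpose H_mat ** \<Lambda> ** H_mat) \<zeta> = h \<bullet> (\<Lambda> *v h)"
    by (simp add: quad_def matrix_vector_mul_assoc[symmetric] inner_transpose_mult h_def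
        del: transpose_matrix_vector)
  ultimately have "quad (M_mat (diag lo) (diag hi) \<Lambda> Z) \<zeta>
      = -2 * (z \<bullet> (diag lo *v (\<Lambda> *v (diag hi *v z))))
        + 2 * (h \<bullet> (\<Lambda> *v ((diag lo + diag hi) *v z))) - 2 * (h \<bullet> (\<Lambda> *v h))"
    by (simp add: M_mat_def quad_add quad_diff quad_scaleR quad_He)
  also have "\<dots> = (\<Sum>i\<in>UNIV. 2 * \<Lambda> $ i $ i * ((h $ i - lo $ i * z $ i) * (hi $ i * z $ i - h $ i)))"
    unfolding inner_vec_def
    by (simp add: diagonal_mult_vec diag is_diagonal_diag is_diagonal_add d
        sum_distrib_left sum_negf[symmetric] sum.distrib[symmetric] sum_subtractf[symmetric] algebra_simps)
  also have "\<dots> \<ge> 0"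
    using sec psd_diagonal_nonneg[OF psd]
    unfolding h static_sector_def by (intro sum_nonneg mult_nonneg_nonneg[of "2 * _"]) auto
  finally show ?thesis .
qed

text \<open>At the stacked vector of \<open>x\<close> and \<open>\<eta>\<close>,
  \<open>F_mat\<close> yields the successor state, \<open>X_mat\<close> the state,
  \<open>H_mat\<close> the layer output and \<open>Z_mat\<close> the argument of
  \<open>\<phi>\<close>. The multiplier term is nonnegative there, so dropping it preserves the
  inequality.\<close>

lemma dissipation_step:
  fixes Ap :: "real^'n^'n" and Bp :: "real^'m^'n" and Cp :: "real^'n^'p"
    and \<phi> :: "'q::finite \<Rightarrow> real \<Rightarrow> real"
  assumes "nonexpansive \<phi>" "static_sector \<phi> lo hi" "lambda_pf \<bar>W\<bar> < 1"
    and "is_diagonal \<Lambda>" "psd \<Lambda>"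
    and lmi: "loewner_le
      (\<beta> *\<^sub>R (transpose (F_mat Ap Bp Cp K V) ** P ** F_mat Ap Bp Cp K V)
        - transpose X_mat ** P ** X_mat
        + transpose X_mat ** Q ** X_mat
        + M_mat (diag lo) (diag hi) \<Lambda> (Z_mat U Cp W)) 0"
  shows "\<beta> * quad P (Ap *v x + Bp *v pi_NN \<phi> W U K V (Cp *v x)) + quad Q x \<le> quad P x"
proof -
  define \<eta> where "\<eta> = implicit_eta \<phi> W U (Cp *v x)"
  define \<zeta> where "\<zeta> = vcat x \<eta>"
  have X: "X_mat *v \<zeta> = x" by (simp add: X_mat_def \<zeta>_def hcat_vcat)
  have H: "H_mat *v \<zeta> = \<eta>" by (simp add: H_mat_def \<zeta>_def hcat_vcat)
  have Z: "Z_mat U Cp W *v \<zeta> = W *v \<eta> + U *v (Cp *v x)"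
    by (simp add: Z_mat_def \<zeta>_def hcat_vcat matrix_vector_mul_assoc)
  have F: "F_mat Ap Bp Cp K V *v \<zeta> = Ap *v x + Bp *v pi_NN \<phi> W U K V (Cp *v x)"
    by (simp add: F_mat_def \<zeta>_def hcat_vcat pi_NN_def \<eta>_def matrix_vector_mul_assoc[symmetric]
        matrix_vector_mult_add_rdistrib matrix_vector_right_distrib)
  have "H_mat *v \<zeta> = act \<phi> (Z_mat U Cp W *v \<zeta>)"
    unfolding H Z \<eta>_def using assms by (intro implicit_eta_fixpoint)
  then have "0 \<le> quad (M_mat (diag lo) (diag hi) \<Lambda> (Z_mat U Cp W)) \<zeta>"
    using assms by (intro sector_multiplier_nonneg)
  moreover have "quad (\<beta> *\<^sub>R (transpose (F_mat Ap Bp Cp K V) ** P ** F_mat Ap Bp Cp K V)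
        - transpose X_mat ** P ** X_mat
        + transpose X_mat ** Q ** X_mat
        + M_mat (diag lo) (diag hi) \<Lambda> (Z_mat U Cp W)) \<zeta> \<le> 0"
  proof -
    \<comment> \<open>\<open>loewner_le A 0\<close> unfolds to \<open>psd (0 - A)\<close>, so the
      sign of the form is reversed through the vanishing form of the zero matrix.\<close>
    have "quad (0 :: real^('n + 'q)^('n + 'q)) \<zeta> = 0" by (simp add: quad_def)
    then show ?thesis
      using lmi unfolding loewner_le_def psd_def quad_diff[of 0] by (metis diff_0 neg_0_le_iff_le)
  qed
  ultimately show ?thesis
    by (simp add: quad_add quad_diff quad_scaleR quad_congruence X F)
qed

lemma discounted_sum_le_storage:
  assumes step: "\<And>k. \<beta> * V (Suc k) + l k \<le> V k"
    and V: "\<And>k. 0 \<le> V k" and l: "\<And>k. 0 \<le> l k" and \<beta>: "0 \<le> (\<beta>::real)"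
  shows "(\<Sum>k. ennreal (\<beta> ^ k * l k)) \<le> ennreal (V 0)"
proof (rule suminf_le_const)
  fix N
  \<comment> \<open>Step \<open>k\<close> is weighted by \<open>\<beta> ^ k\<close> so that the
    storage terms telescope. The remainder is kept for the induction and dropped afterwards by
    nonnegativity.\<close>
  have "(\<Sum>k<N. \<beta> ^ k * l k) \<le> V 0 - \<beta> ^ N * V N"
  proof (induction N)
    case (Suc N)
    have "\<beta> ^ N * (\<beta> * V (Suc N) + l N) \<le> \<beta> ^ N * V N"
      using step \<beta> by (intro mult_left_mono) auto
    then show ?case using Suc by (simp add: algebra_simps)
  qed simp
  also have "\<dots> \<le> V 0" using V \<beta> by simp
  finally show "(\<Sum>k<N. ennreal (\<beta> ^ k * l k)) \<le> ennreal (V 0)"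
    using l \<beta> by (subst sum_ennreal) (auto intro!: ennreal_leI)
qed simp

text \<open>\<open>f\<close> may be unbounded on the whole space, but it is bounded on
  \<open>X\<close>, which carries almost all of the mass of a finite measure.\<close>

lemma integrable_continuous_compact_support:
  fixes f :: "'a::euclidean_space \<Rightarrow> real"
  assumes "compact X" "prob_space \<mu>" "sets \<mu> = sets borel" "AE x in \<mu>. x \<in> X"
    and f: "continuous_on UNIV f"
  shows "integrable \<mu> f"
proof -
  interpret prob_space \<mu> by fact
  have "compact (f ` X)"
    using assms f by (intro compact_continuous_image) (auto intro: continuous_on_subset)
  then obtain B where "\<And>x. x \<in> X \<Longrightarrow> norm (f x) \<le> B"
    by (meson bounded_iff compact_imp_bounded imageI)
  moreover have "f \<in> borel_measurable \<mu>"
    using borel_measurable_continuous_onI[OF f] assms(3) measurable_cong_sets by blast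
  ultimately show ?thesis using assms(4) by (intro integrable_const_bound) auto
qed

text \<open>Expanding the form into monomials and integrating term by term leaves the entries of the
  second moment matrix; integrability of each monomial justifies the interchange.\<close>

lemma integral_quad_eq_trace:
  fixes \<mu> :: "(real^'n) measure"
  assumes "\<And>i j. integrable \<mu> (\<lambda>x. x $ i * x $ j)"
  shows "(\<integral>x. quad P x \<partial>\<mu>) = trace (P ** second_moment \<mu>)"
proof -
  have "(\<integral>x. quad P x \<partial>\<mu>) = (\<Sum>i\<in>UNIV. \<Sum>j\<in>UNIV. P $ i $ j * (\<integral>x. x $ i * x $ j \<partial>\<mu>))"
    unfolding quad_sum using assms by simp
  also have "\<dots> = trace (P ** second_moment \<mu>)"
    by (simp add: trace_def matrix_matrix_mult_def second_moment_def mult.commute)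
  finally show ?thesis .
qed

section \<open>Lower bound for linear controllers\<close>

text \<open>All stage costs are nonnegative, so the first two bound the series from below.
  Integrability converts the real-valued integrals of \<open>L_lin\<close> into the extended
  nonnegative integral of \<open>disc_cost\<close>.\<close>

lemma disc_cost_ge_two_stages:
  assumes "psd Q" "0 \<le> \<beta>" and [simp]: "\<And>x0. x x0 0 = x0"
    and int: "integrable \<mu> (\<lambda>x0. quad Q x0)" "integrable \<mu> (\<lambda>x0. quad Q (x x0 (Suc 0)))"
  shows "ennreal ((\<integral>x0. quad Q x0 \<partial>\<mu>) + \<beta> * (\<integral>x0. quad Q (x x0 (Suc 0)) \<partial>\<mu>))
    \<le> disc_cost \<mu> \<beta> Q x"
proof -
  have Q: "0 \<le> quad Q y" for y using assms by (simp add: psd_def)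
  have "ennreal ((\<integral>x0. quad Q x0 \<partial>\<mu>) + \<beta> * (\<integral>x0. quad Q (x x0 (Suc 0)) \<partial>\<mu>))
      = ennreal (\<integral>x0. quad Q x0 + \<beta> * quad Q (x x0 (Suc 0)) \<partial>\<mu>)"
    using int by simp
  also have "\<dots> = (\<integral>\<^sup>+ x0. ennreal (quad Q x0 + \<beta> * quad Q (x x0 (Suc 0))) \<partial>\<mu>)"
    using int Q \<open>0 \<le> \<beta>\<close> by (intro nn_integral_eq_integral[symmetric]) auto
  also have "\<dots> \<le> disc_cost \<mu> \<beta> Q x"
    unfolding disc_cost_def
  proof (rule nn_integral_mono)
    fix x0
    have "ennreal (quad Q x0 + \<beta> * quad Q (x x0 (Suc 0)))
        = (\<Sum>k<2. ennreal (\<beta> ^ k * quad Q (x x0 k)))"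
      using Q \<open>0 \<le> \<beta>\<close> by (simp add: numeral_2_eq_2)
    also have "\<dots> \<le> (\<Sum>k. ennreal (\<beta> ^ k * quad Q (x x0 k)))"
      by (rule sum_le_suminf) auto
    finally show "ennreal (quad Q x0 + \<beta> * quad Q (x x0 (Suc 0)))
        \<le> (\<Sum>k. ennreal (\<beta> ^ k * quad Q (x x0 k)))" .
  qed
  finally show ?thesis .
qed

text \<open>A real infimum lies below its members only if the set is bounded below; here 0 is a
  lower bound because \<open>Q\<close> is positive semidefinite.\<close>

lemma L_lin_le:
  assumes "psd Q" "0 \<le> \<beta>" "(Dy, d) \<in> aff_moves Cp Hu hu X"
  shows "L_lin Ap Bp Cp Hu hu X \<mu> \<beta> Q
    \<le> (\<integral>x. quad Q x \<partial>\<mu>) + \<beta> * (\<integral>x. quad Q (Ap *v x + Bp *v (Dy *v (Cp *v x) + d)) \<partial>\<mu>)"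
proof -
  have "bdd_below ((\<lambda>(Dy, d). \<integral>x. quad Q (Ap *v x + Bp *v (Dy *v (Cp *v x) + d)) \<partial>\<mu>)
      ` aff_moves Cp Hu hu X)"
    using assms(1) by (intro bdd_belowI2[where m = 0]) (auto simp: psd_def intro!: integral_nonneg_AE)
  from cINF_lower[OF this assms(3)] show ?thesis
    unfolding L_lin_def using assms(2) by (auto intro!: mult_left_mono)
qed

theorem theorem9:
  fixes Ap :: "real^'n^'n" and Bp :: "real^'m^'n" and Cp :: "real^'n^'p"
    and X :: "(real^'n) set" and \<mu> :: "(real^'n) measure"
    and Hu :: "real^'m^'r" and hu :: "real^'r"
    and \<beta> :: real and Q :: "real^'n^'n"
    and \<phi> :: "'q::finite \<Rightarrow> real \<Rightarrow> real"
    and W :: "real^'q^'q" and U :: "real^'p^'q" and K :: "real^'p^'m" and V :: "real^'q^'m"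
    and lo hi :: "real^'q"
    and P :: "real^'n^'n" and \<Lambda> :: "real^'q^'q"
  assumes "compact X"
    and "prob_space \<mu>" and "sets \<mu> = sets borel" and "AE x in \<mu>. x \<in> X"
    and "compact {u. Hu *v u \<le> hu}"
    and "0 < \<beta>" and "\<beta> \<le> 1"
    and "psd Q"
    and "nonexpansive \<phi>" and "static_sector \<phi> lo hi"
    and "lambda_pf \<bar>W\<bar> < 1"
    and "\<And>k x0. x0 \<in> X \<Longrightarrow>
      Hu *v pi_NN \<phi> W U K V (Cp *v static_loop Ap Bp Cp (pi_NN \<phi> W U K V) x0 k) \<le> hu"
    and "pos_def P" and "is_diagonal \<Lambda>" and "psd \<Lambda>"
    and "loewner_le
      (\<beta> *\<^sub>R (transpose (F_mat Ap Bp Cp K V) ** P ** F_mat Ap Bp Cp K V)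
        - transpose X_mat ** P ** X_mat
        + transpose X_mat ** Q ** X_mat
        + M_mat (diag lo) (diag hi) \<Lambda> (Z_mat U Cp W)) 0"
    and "trace (P ** second_moment \<mu>) < L_lin Ap Bp Cp Hu hu X \<mu> \<beta> Q"
  shows "\<forall>c :: ('m::finite, 'p::finite) lti_controller.
    input_admissible Hu hu X (lti_input Ap Bp Cp c) \<longrightarrow>
      disc_cost \<mu> \<beta> Q (static_loop Ap Bp Cp (pi_NN \<phi> W U K V))
        < disc_cost \<mu> \<beta> Q (lti_state Ap Bp Cp c)"
proof (intro allI impI)
  note base = \<open>compact X\<close> \<open>prob_space \<mu>\<close> \<open>sets \<mu> = sets borel\<close> \<open>AE x in \<mu>. x \<in> X\<close>
  fix c :: "('m::finite, 'p::finite) lti_controller"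
  assume adm: "input_admissible Hu hu X (lti_input Ap Bp Cp c)"
  have P: "0 \<le> quad P x" for x
    using \<open>pos_def P\<close> by (cases "x = 0") (auto simp: pos_def_def quad_def less_imp_le)
  have Q: "0 \<le> quad Q x" for x using \<open>psd Q\<close> by (simp add: psd_def)
  have intP: "integrable \<mu> (\<lambda>x. quad P x)"
    by (intro integrable_continuous_compact_support[OF base] continuous_on_quad continuous_on_id)
  have int2: "integrable \<mu> (\<lambda>x. x $ i * x $ j)" for i j
    by (intro integrable_continuous_compact_support[OF base] continuous_intros)

  have "disc_cost \<mu> \<beta> Q (static_loop Ap Bp Cp (pi_NN \<phi> W U K V)) \<le> (\<integral>\<^sup>+ x. ennreal (quad P x) \<partial>\<mu>)"
    unfolding disc_cost_def
  proof (rule nn_integral_mono)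
    fix x
    let ?x = "static_loop Ap Bp Cp (pi_NN \<phi> W U K V) x"
    \<comment> \<open>The dissipation inequality holds at every state, so the cost is bounded
      pointwise in the initial state before integrating.\<close>
    have "\<beta> * quad P (?x (Suc k)) + quad Q (?x k) \<le> quad P (?x k)" for k
      unfolding static_loop.simps using assms by (intro dissipation_step)
    then have "(\<Sum>k. ennreal (\<beta> ^ k * quad Q (?x k))) \<le> ennreal (quad P (?x 0))"
      using \<open>0 < \<beta>\<close> P Q by (intro discounted_sum_le_storage[where V = "\<lambda>k. quad P (?x k)"]) auto
    then show "(\<Sum>k. ennreal (\<beta> ^ k * quad Q (?x k))) \<le> ennreal (quad P x)" by simp
  qed
  also have "\<dots> = ennreal (\<integral>x. quad P x \<partial>\<mu>)"
    using intP P by (intro nn_integral_eq_integral) auto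
  also have "(\<integral>x. quad P x \<partial>\<mu>) = trace (P ** second_moment \<mu>)"
    using int2 by (rule integral_quad_eq_trace)
  also have "ennreal (trace (P ** second_moment \<mu>)) < ennreal (L_lin Ap Bp Cp Hu hu X \<mu> \<beta> Q)"
  proof -
    \<comment> \<open>\<open>ennreal\<close> sends negative reals to 0, so the strict inequality
      carries over once its smaller side is known to be nonnegative.\<close>
    have "0 \<le> trace (P ** second_moment \<mu>)"
      using integral_quad_eq_trace[OF int2, of P] P by (metis integral_nonneg_AE AE_I2)
    then show ?thesis
      using \<open>trace (P ** second_moment \<mu>) < L_lin Ap Bp Cp Hu hu X \<mu> \<beta> Q\<close>
      by (simp add: ennreal_less_iff)
  qed
  also have "\<dots> \<le> disc_cost \<mu> \<beta> Q (lti_state Ap Bp Cp c)"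
  proof -
    \<comment> \<open>The contribution of the initial controller state to the first input. It does
      not vary with the plant state, so it is the constant offset of an affine move.\<close>
    define d where "d = (\<Sum>j<ctrl_order c. ctrl_init c j *\<^sub>R ctrl_C c j)"
    have u: "lti_input Ap Bp Cp c x 0 = ctrl_D c *v (Cp *v x) + d" for x
      by (simp add: lti_input_def ctrl_output_def d_def)
    have x1: "lti_state Ap Bp Cp c x (Suc 0)
        = Ap *v x + Bp *v (ctrl_D c *v (Cp *v x) + d)" for x
      by (simp add: lti_state_def ctrl_output_def d_def add.commute Let_def)
    \<comment> \<open>This is admissibility at time 0, for all initial states in
      \<open>X\<close>.\<close>
    have "(ctrl_D c, d) \<in> aff_moves Cp Hu hu X"
      using adm u by (auto simp: aff_moves_def input_admissible_def) (metis u)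
    then have "L_lin Ap Bp Cp Hu hu X \<mu> \<beta> Q
        \<le> (\<integral>x. quad Q x \<partial>\<mu>) + \<beta> * (\<integral>x. quad Q (lti_state Ap Bp Cp c x (Suc 0)) \<partial>\<mu>)"
      unfolding x1 using \<open>psd Q\<close> \<open>0 < \<beta>\<close> by (intro L_lin_le) auto
    moreover have "ennreal \<dots> \<le> disc_cost \<mu> \<beta> Q (lti_state Ap Bp Cp c)"
    proof (rule disc_cost_ge_two_stages)
      show "integrable \<mu> (\<lambda>x. quad Q x)"
        by (intro integrable_continuous_compact_support[OF base] continuous_on_quad continuous_on_id)
      have lin: "continuous_on UNIV (\<lambda>x. A *v f x)" if "continuous_on UNIV f"
        for A :: "real^'b^'c" and f :: "real^'n \<Rightarrow> real^'b"
        using that by (intro continuous_on_compose2[OF linear_continuous_on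
              [OF matrix_vector_mul_bounded_linear]]) auto
      show "integrable \<mu> (\<lambda>x. quad Q (lti_state Ap Bp Cp c x (Suc 0)))"
        unfolding x1
        by (intro integrable_continuous_compact_support[OF base] continuous_on_quad
            continuous_on_add lin continuous_on_id continuous_on_const)
    qed (use \<open>psd Q\<close> \<open>0 < \<beta>\<close> in \<open>auto simp: lti_state_def\<close>)
    ultimately show ?thesis by (meson ennreal_leI order_trans)
  qed
  finally show "disc_cost \<mu> \<beta> Q (static_loop Ap Bp Cp (pi_NN \<phi> W U K V))
      < disc_cost \<mu> \<beta> Q (lti_state Ap Bp Cp c)" .
qed

end
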